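(* Let $f_1,\ldots,f_m$ be injective contractions on $\mathbb{R}^2$ satisfying the Open Set Condition, and let $T$ be their attractor, i.e. the unique nonempty compact set $T\subset\mathbb{R}^2$ with $T=\bigcup_{i=1}^m f_i(T)$. Suppose that $T$ is connected. Then the boundary $\partial T$ (in $\mathbb{R}^2$) is arcwise connected.
   Context: A map $f:\mathbb{R}^2\to\mathbb{R}^2$ is a contraction if $\sup_{x\neq y}|f(x)-f(y)|/|x-y|<1$. The family $f_1,\ldots,f_m$ satisfies the Open Set Condition if there is a nonempty bounded open set $V\subset\mathbb{R}^2$ such that $f_i(V)\cap f_j(V)=\emptyset$ for $i\neq j$ and $\bigcup_{i=1}^m f_i(V)\subset V$. A set is arcwise connected if any two of its points are the endpoints of an arc (a homeomorphic image of $[0,1]$) contained in the set. *)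

theory Defs
  imports "HOL-Analysis.Analysis"
begin

type_synonym plane = "real ^ 2"

definition contraction :: "(plane \<Rightarrow> plane) \<Rightarrow> bool" where
  "contraction f \<longleftrightarrow> (\<exists>c<1. \<forall>x y. x \<noteq> y \<longrightarrow> dist (f x) (f y) / dist x y \<le> c)"

definition open_set_condition :: "nat \<Rightarrow> (nat \<Rightarrow> plane \<Rightarrow> plane) \<Rightarrow> bool" where
  "open_set_condition m f \<longleftrightarrow>
     (\<exists>V::plane set. V \<noteq> {} \<and> bounded V \<and> open V \<and>
        (\<forall>i\<in>{1..m}. \<forall>j\<in>{1..m}. i \<noteq> j \<longrightarrow> f i ` V \<inter> f j ` V = {}) \<and>
        (\<Union>i\<in>{1..m}. f i ` V) \<subseteq> V)"

definition arcwise_connected :: "'a::topological_space set \<Rightarrow> bool" where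
  "arcwise_connected S \<longleftrightarrow>
     (\<forall>x\<in>S. \<forall>y\<in>S. x \<noteq> y \<longrightarrow>
        (\<exists>g. arc g \<and> path_image g \<subseteq> S \<and> pathstart g = x \<and> pathfinish g = y))"

end

theory Submission
  imports Defs
begin

text \<open>
  Call a set \<open>X\<close> uniformly locally connected if nearby points of \<open>X\<close> lie in a small connected subset
  of \<open>X\<close>; a complete connected set of this kind is path connected, hence arcwise connected. A set
  that is, at every scale, a finite union of small compact connected sets is uniformly locally
  connected, so \<open>T\<close> and finite unions of tiles qualify. This settles the case of empty interior,
  where the boundary is \<open>T\<close> itself.

  If \<open>T\<close> has interior points, some iterate \<open>w\<close> maps \<open>T\<close> into a ball contained in \<open>T\<close>. The
  Open Set Condition makes distinct tiles of one level non-overlapping, so \<open>w(\<partial>T) = w(T) \<inter> K\<close>, where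
  \<open>K\<close> is the union of the other tiles of the same level. Both \<open>w(T)\<close> and \<open>K\<close> are
  uniformly locally connected, and together they cover a neighbourhood of \<open>w(\<partial>T)\<close>. By a local form of
  unicoherence, proved by lifting a circle-valued map, \<open>w(\<partial>T)\<close> is uniformly locally connected.

  For connectedness of \<open>\<partial>T\<close> it suffices, by unicoherence of the plane, that the complement of the
  interior of \<open>T\<close> is connected. Otherwise it has a bounded clopen part \<open>E\<close>; a copy \<open>g(E)\<close> inside
  \<open>T\<close> is covered by tiles, and a tile \<open>h(T)\<close> meeting \<open>g(E - T)\<close> cannot leave \<open>g(E)\<close>, so it has a
  strictly smaller filled hull than \<open>g(T)\<close>. As there are finitely many tiles, this descent is absurd.
\<close>

section \<open>Uniform local connectedness\<close>

definition uniformly_locally_connected :: "'a::metric_space set \<Rightarrow> bool" where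
  "uniformly_locally_connected S \<longleftrightarrow>
     (\<forall>e>0. \<exists>d>0. \<forall>x\<in>S. \<forall>y\<in>S. dist x y < d \<longrightarrow>
        (\<exists>C\<subseteq>S. connected C \<and> x \<in> C \<and> y \<in> C \<and> C \<subseteq> ball x e))"

text \<open>This is Sierpinski's property S, with compact pieces so that disjoint pieces have
  positive distance.\<close>

definition property_S :: "'a::metric_space set \<Rightarrow> bool" where
  "property_S S \<longleftrightarrow>
     (\<forall>e>0. \<exists>F. finite F \<and> \<Union>F = S \<and>
        (\<forall>C\<in>F. compact C \<and> connected C \<and> (\<forall>x\<in>C. \<forall>y\<in>C. dist x y < e)))"

text \<open>Joinability by short steps is an equivalence relation with open classes, so a connected
  set has just one class. Staying at \<open>b\<close> from \<open>n\<close> on lets chains of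
  different lengths be padded to a common one.\<close>

lemma connected_imp_chain:
  fixes S :: "'a::metric_space set"
  assumes "connected S" "a \<in> S" "b \<in> S" "d > 0"
  obtains n c where "c 0 = a" "\<And>i. n \<le> i \<Longrightarrow> c i = b" "\<And>i. c i \<in> S"
    "\<And>i. dist (c i) (c (Suc i)) < d"
proof -
  define P where "P = (\<lambda>x y. x \<in> S \<and> y \<in> S \<and> dist x y < d)"
  have sym: "symp P\<^sup>*\<^sup>*"
    by (rule symp_rtranclp) (auto simp: symp_def P_def dist_commute)
  have "P\<^sup>*\<^sup>* a b"
  proof (rule connected_equivalence_relation [OF assms(1-3)])
    show "\<exists>U. openin (top_of_set S) U \<and> x \<in> U \<and> (\<forall>y\<in>U. P\<^sup>*\<^sup>* x y)" if "x \<in> S" for x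
    proof (intro exI conjI ballI)
      show "openin (top_of_set S) (S \<inter> ball x d)" by auto
      show "P\<^sup>*\<^sup>* x y" if "y \<in> S \<inter> ball x d" for y
        using that \<open>x \<in> S\<close> by (auto simp: P_def)
    qed (use that assms in auto)
    show "P\<^sup>*\<^sup>* y x" if "P\<^sup>*\<^sup>* x y" for x y
      using sym that by (auto simp: symp_def)
  qed auto
  then obtain n where "(P ^^ n) a b" by (auto simp: rtranclp_power)
  then obtain c where c: "c 0 = a" "c n = b" "\<And>i. i < n \<Longrightarrow> P (c i) (c (Suc i))"
    by (auto simp: relpowp_fun_conv)
  define c' where "c' i = c (min i n)" for i
  have "c' i \<in> S" for i
  proof (cases "i < n")
    case True then show ?thesis using c(3)[of i] by (simp add: c'_def P_def)
  next
    case False then show ?thesis using assms c by (simp add: c'_def min_absorb2)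
  qed
  moreover have "dist (c' i) (c' (Suc i)) < d" for i
  proof (cases "i < n")
    case True then show ?thesis using c(3)[of i] by (simp add: c'_def P_def min_absorb1)
  next
    case False then show ?thesis using assms c by (simp add: c'_def min_absorb2)
  qed
  ultimately show thesis
    using that[of c' n] c by (simp add: c'_def min_absorb2)
qed

text \<open>Chains from \<open>a\<close> to \<open>b\<close> are refined repeatedly, each link
  within the small connected set joining its ends. Completeness keeps the uniform limit in
  \<open>S\<close>, and the shrinking links make it continuous.\<close>

lemma complete_ulc_imp_path_connected:
  fixes S :: "'a::metric_space set"
  assumes "complete S" "connected S" and ulc: "uniformly_locally_connected S"
  shows "path_connected S"
  unfolding path_connected_def
proof (intro ballI)
  fix a b assume ab: "a \<in> S" "b \<in> S"
  define R where "R = (\<lambda>(n::nat) x y. \<exists>C\<subseteq>S. connected C \<and> x \<in> C \<and> y \<in> C \<and> C \<subseteq> ball x ((1/2)^n))"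
  have "\<forall>n. \<exists>d>0. \<forall>x\<in>S. \<forall>y\<in>S. dist x y < d \<longrightarrow> R n x y"
    using ulc unfolding uniformly_locally_connected_def R_def by auto
  then obtain d where d: "\<And>n. d n > 0"
      "\<And>n x y. \<lbrakk>x \<in> S; y \<in> S; dist x y < d n\<rbrakk> \<Longrightarrow> R n x y"
    by metis
  define P where "P = (\<lambda>k (N, x). N > (0::nat) \<and> (\<forall>i. x i \<in> S) \<and> x 0 = a \<and> x N = b \<and>
      (\<forall>i<N. R k (x i) (x (Suc i))))"
  define Q where "Q = (\<lambda>(k::nat) (N, x) (N', y::nat \<Rightarrow> 'a). \<exists>M>(0::nat). N' = N * M \<and>
      (\<forall>j\<le>N'. dist (y j) (x (j div M)) < (1/2)^k))"
  \<comment> \<open>A state \<open>(N, x)\<close> of level \<open>k\<close> is a chain from \<open>a\<close> to \<open>b\<close>; each link is replaced by \<open>M\<close> finer ones,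
    the same number for all links, so that the step functions \<open>t \<mapsto> x \<lfloor>t N\<rfloor>\<close> converge uniformly.\<close>
  have "\<exists>s. \<forall>k. P k (s k) \<and> Q k (s k) (s (Suc k))"
  proof (rule dependent_nat_choice)
    obtain n c where "c 0 = a" "\<And>i. n \<le> i \<Longrightarrow> c i = b" "\<And>i. c i \<in> S"
      "\<And>i. dist (c i) (c (Suc i)) < d 0"
      using connected_imp_chain [OF assms(2) ab, of "d 0"] d by metis
    \<comment> \<open>Length \<open>Suc n\<close> leaves at least one link even if
      \<open>n = 0\<close>.\<close>
    then have "P 0 (Suc n, c)" using d by (auto simp: P_def)
    then show "\<exists>s. P 0 s" ..
  next
    fix s k assume Ps: "P k s"
    obtain N x where s: "s = (N, x)" by (cases s)
    have N: "N > 0" and x: "\<And>i. x i \<in> S" "x 0 = a" "x N = b"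
      and Rx: "\<And>i. i < N \<Longrightarrow> R k (x i) (x (Suc i))"
      using Ps by (auto simp: P_def s)
    have "\<exists>n c. c 0 = x i \<and> (\<forall>j\<ge>n. c j = x (Suc i)) \<and> (\<forall>j. c j \<in> S \<and> dist (x i) (c j) < (1/2)^k) \<and>
       (\<forall>j. dist (c j) (c (Suc j)) < d (Suc k))" if i: "i < N" for i
    proof -
      obtain C where C: "C \<subseteq> S" "connected C" "x i \<in> C" "x (Suc i) \<in> C" "C \<subseteq> ball (x i) ((1/2)^k)"
        using Rx[OF i] unfolding R_def by blast
      obtain n c where "c 0 = x i" "\<And>j. n \<le> j \<Longrightarrow> c j = x (Suc i)" and cC: "\<And>j. c j \<in> C"
        "\<And>j. dist (c j) (c (Suc j)) < d (Suc k)"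
        using connected_imp_chain [OF C(2-4), of "d (Suc k)"] d by metis
      moreover have "c j \<in> S \<and> dist (x i) (c j) < (1/2)^k" for j
        using cC(1)[of j] C(1,5) by auto
      ultimately show ?thesis by blast
    qed
    then obtain n c where c: "\<And>i. i < N \<Longrightarrow> c i 0 = x i"
      "\<And>i j. \<lbrakk>i < N; j \<ge> n i\<rbrakk> \<Longrightarrow> c i j = x (Suc i)"
      "\<And>i j. i < N \<Longrightarrow> c i j \<in> S" "\<And>i j. i < N \<Longrightarrow> dist (x i) (c i j) < (1/2)^k"
      "\<And>i j. i < N \<Longrightarrow> dist (c i j) (c i (Suc j)) < d (Suc k)"
      by metis
    \<comment> \<open>One number of subdivisions serves all links, since \<open>c i\<close> is
      constant from \<open>n i\<close> on; \<open>Suc\<close> makes it positive.\<close>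
    define M where "M = Suc (Max (n ` {..<N}))"
    have M: "M > 0" by (simp add: M_def)
    have nM: "n i \<le> M" if "i < N" for i
      using that by (simp add: M_def le_SucI)
    define y where "y j = (if j div M < N then c (j div M) (j mod M) else b)" for j
    have yS: "y j \<in> S" for j using c(3) ab by (simp add: y_def)
    have "R (Suc k) (y j) (y (Suc j))" if j: "j < N * M" for j
    proof -
      have jN: "j div M < N" using j M by (simp add: less_mult_imp_div_less)
      have "dist (y j) (y (Suc j)) < d (Suc k)"
      proof (cases "Suc (j mod M) = M")
        case True
        have sj: "Suc j div M = Suc (j div M)" "Suc j mod M = 0"
          using True by (auto simp: div_Suc mod_Suc)
        have "y (Suc j) = x (Suc (j div M))"
        proof (cases "Suc (j div M) < N")
          case True then show ?thesis using c(1) sj by (simp add: y_def)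
        next
          case False then have "Suc (j div M) = N" using jN by simp
          then show ?thesis using x sj by (simp add: y_def)
        qed
        also have "\<dots> = c (j div M) (Suc (j mod M))"
          using c(2)[OF jN, of "Suc (j mod M)"] nM[OF jN] True by simp
        finally show ?thesis using c(5)[OF jN] jN by (simp add: y_def)
      next
        case False
        then have "Suc j div M = j div M" "Suc j mod M = Suc (j mod M)"
          by (auto simp: div_Suc mod_Suc)
        then show ?thesis using c(5)[OF jN] jN by (simp add: y_def)
      qed
      then show ?thesis using d yS by blast
    qed
    then have "P (Suc k) (N * M, y)"
      using yS N M x c(1) by (auto simp: P_def y_def)
    moreover have "dist (y j) (x (j div M)) < (1/2)^k" if "j \<le> N * M" for j
    proof (cases "j div M < N")
      case True then show ?thesis using c(4) by (simp add: y_def dist_commute)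
    next
      case False
      then have "j div M = N" using that M
        by (metis div_le_mono le_antisym linorder_not_le nonzero_mult_div_cancel_right not_less_zero)
      then show ?thesis using x by (simp add: y_def)
    qed
    ultimately show "\<exists>s'. P (Suc k) s' \<and> Q k s s'"
      using M by (auto simp: Q_def s)
  qed
  then obtain s where s: "\<And>k. P k (s k)" "\<And>k. Q k (s k) (s (Suc k))" by blast
  define N where "N k = fst (s k)" for k
  define x where "x k = snd (s k)" for k
  have N: "N k > 0" and xS: "x k i \<in> S" and x0: "x k 0 = a" and xN: "x k (N k) = b"
    and Rx: "i < N k \<Longrightarrow> R k (x k i) (x k (Suc i))" for k i
    using s(1)[of k] by (auto simp: P_def N_def x_def split: prod.splits)
  define g where "g k t = x k (nat \<lfloor>t * real (N k)\<rfloor>)" for k t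
  have gS: "g k t \<in> S" for k t by (simp add: g_def xS)
  have step: "dist (g (Suc k) t) (g k t) < (1/2)^k" if t: "t \<in> {0..1}" for k t
  proof -
    obtain M where M: "M > 0" "N (Suc k) = N k * M"
      "\<And>j. j \<le> N (Suc k) \<Longrightarrow> dist (x (Suc k) j) (x k (j div M)) < (1/2)^k"
      using s(2)[of k] by (auto simp: Q_def N_def x_def split: prod.splits)
    define j where "j = nat \<lfloor>t * real (N (Suc k))\<rfloor>"
    have "t * real (N (Suc k)) \<le> real (N (Suc k))" using t by (simp add: mult_left_le_one_le)
    then have "j \<le> N (Suc k)" unfolding j_def by linarith
    \<comment> \<open>Nested floors agree, so the finer index falls into the block that refines the
      coarser one. The common block length \<open>M\<close> makes this work.\<close>
    moreover have "j div M = nat \<lfloor>t * real (N k)\<rfloor>"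
    proof -
      have "\<lfloor>t * real (N k)\<rfloor> = \<lfloor>(t * real (N (Suc k))) / real_of_int (int M)\<rfloor>"
        using M by simp
      also have "\<dots> = \<lfloor>t * real (N (Suc k))\<rfloor> div int M"
        by (rule floor_divide_real_eq_div) simp
      finally show ?thesis using t by (simp add: j_def nat_div_distrib)
    qed
    ultimately show ?thesis using M(3)[of j] by (simp add: g_def j_def)
  qed
  \<comment> \<open>The exact partial sum of the geometric series is kept so that the induction
    closes.\<close>
  have far: "dist (g (k + j) t) (g k t) \<le> 2 * (1/2)^k - 2 * (1/2)^(k+j)" if t: "t \<in> {0..1}" for j k t
  proof (induction j)
    case (Suc j)
    have "dist (g (k + Suc j) t) (g k t) \<le> dist (g (Suc (k+j)) t) (g (k+j) t) + dist (g (k+j) t) (g k t)"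
      by (simp add: dist_triangle)
    then show ?case using Suc step[OF t, of "k+j"] by simp
  qed simp
  have far': "dist (g n t) (g k t) \<le> 2 * (1/2)^k" if t: "t \<in> {0..1}" "k \<le> n" for n k t
  proof -
    have "(0::real) \<le> 2 * (1/2)^n" by simp
    then show ?thesis using far[OF t(1), of k "n - k"] t(2) by (smt (verit) le_add_diff_inverse)
  qed
  have small: "\<exists>k. c * (1/2)^k < e" if ec: "e > 0" "c > 0" for e c :: real
  proof -
    obtain k where "(1/2::real)^k < e / c"
      using real_arch_pow_inv[OF divide_pos_pos[OF ec], of "1/2"] by auto
    then show ?thesis using ec by (auto simp: field_simps)
  qed
  have "\<exists>l\<in>S. (\<lambda>n. g n t) \<longlonglongrightarrow> l" if t: "t \<in> {0..1}" for t
  proof -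
    have "Cauchy (\<lambda>n. g n t)"
      unfolding Cauchy_altdef
    proof (intro allI impI)
      fix e :: real assume "e > 0"
      then obtain k where k: "4 * (1/2)^k < e" using small[of e 4] by auto
      have "dist (g m t) (g n t) < e" if "m \<ge> k" "n > m" for m n
      proof -
        have "dist (g m t) (g n t) \<le> dist (g m t) (g k t) + dist (g n t) (g k t)"
          by (rule dist_triangle2)
        then show ?thesis using far'[OF t, of k m] far'[OF t, of k n] that k by linarith
      qed
      then show "\<exists>M. \<forall>m\<ge>M. \<forall>n>m. dist (g m t) (g n t) < e" by blast
    qed
    then show ?thesis using assms(1) gS by (auto simp: complete_def)
  qed
  then obtain h where h: "\<And>t. t \<in> {0..1} \<Longrightarrow> h t \<in> S" "\<And>t. t \<in> {0..1} \<Longrightarrow> (\<lambda>n. g n t) \<longlonglongrightarrow> h t"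
    by metis
  have hg: "dist (h t) (g k t) \<le> 2 * (1/2)^k" if t: "t \<in> {0..1}" for t k
  proof (rule Lim_bounded)
    show "(\<lambda>n. dist (g n t) (g k t)) \<longlonglongrightarrow> dist (h t) (g k t)"
      by (intro tendsto_intros h t)
  qed (use far'[OF t] in blast)
  have "continuous_on {0..1} h"
    unfolding continuous_on_iff
  proof (intro ballI allI impI)
    fix t e assume t: "t \<in> {0..1::real}" and "e > (0::real)"
    \<comment> \<open>The factor is 2 + 1 + 2: two distances from \<open>h\<close> to
      \<open>g k\<close>, and one link of the chain between equal or adjacent indices.\<close>
    then obtain k where k: "5 * (1/2)^k < e" using small[of e 5] by auto
    have near: "dist (g k u) (g k v) < (1/2)^k" if "u \<in> {0..1}" "v \<in> {0..1}" "u \<le> v" "v - u < 1 / N k" for u v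
    proof -
      define i where "i = nat \<lfloor>u * real (N k)\<rfloor>"
      define j where "j = nat \<lfloor>v * real (N k)\<rfloor>"
      have "(v - u) * N k < 1" using that N[of k] by (simp add: field_simps)
      then have "v * real (N k) < u * real (N k) + 1" by (simp add: algebra_simps)
      moreover have "u * real (N k) \<le> v * real (N k)" using that by (simp add: mult_right_mono)
      moreover have "v * real (N k) \<le> real (N k)" using that by (simp add: mult_left_le_one_le)
      moreover have "0 \<le> u * real (N k)" using that by simp
      ultimately have "j = i \<or> j = Suc i \<and> i < N k"
        unfolding i_def j_def by linarith
      then have "dist (x k i) (x k j) < (1/2)^k"
        using Rx[of i k] by (auto simp: R_def subset_iff)
      then show ?thesis by (simp add: g_def i_def j_def)
    qed
    show "\<exists>d>0. \<forall>u\<in>{0..1}. dist u t < d \<longrightarrow> dist (h u) (h t) < e"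
    proof (intro exI conjI ballI impI)
      show "1 / real (N k) > 0" using N by simp
      fix u assume u: "u \<in> {0..1::real}" "dist u t < 1 / real (N k)"
      have "dist (g k u) (g k t) < (1/2)^k"
      proof (cases "u \<le> t")
        case True then show ?thesis using near[of u t] u t by (simp add: dist_real_def)
      next
        case False then show ?thesis using near[of t u] u t by (simp add: dist_real_def dist_commute)
      qed
      moreover have "dist (h u) (h t) \<le> dist (h u) (g k u) + dist (g k u) (g k t) + dist (h t) (g k t)"
        by (metric)
      ultimately show "dist (h u) (h t) < e"
        using hg[OF u(1), of k] hg[OF t, of k] k by linarith
    qed
  qed
  moreover have "h 0 = a"
  proof -
    have "g n 0 = a" for n by (simp add: g_def x0)
    then show ?thesis using h(2)[of 0] LIMSEQ_unique[of "\<lambda>n. a" a] by auto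
  qed
  moreover have "h 1 = b"
  proof -
    have "g n 1 = b" for n by (simp add: g_def xN)
    then show ?thesis using h(2)[of 1] LIMSEQ_unique[of "\<lambda>n. b" b] by auto
  qed
  ultimately show "\<exists>g. path g \<and> path_image g \<subseteq> S \<and> pathstart g = a \<and> pathfinish g = b"
    using h(1) by (intro exI[of _ h]) (auto simp: path_def path_image_def pathstart_def pathfinish_def)
qed

text \<open>Among finitely many compact pieces, disjoint ones are at least some common distance
  apart. Points closer than that lie in pieces that meet, and the union of these two is the small
  connected set.\<close>

lemma property_S_imp_ulc:
  fixes S :: "'a::heine_borel set"
  assumes "property_S S"
  shows "uniformly_locally_connected S"
  unfolding uniformly_locally_connected_def
proof (intro allI impI)
  fix e :: real assume "e > 0"
  then obtain F where F: "finite F" "\<Union>F = S" and C: "\<And>C. C \<in> F \<Longrightarrow> compact C" "\<And>C. C \<in> F \<Longrightarrow> connected C"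
      "\<And>C x y. \<lbrakk>C \<in> F; x \<in> C; y \<in> C\<rbrakk> \<Longrightarrow> dist x y < e/2"
    using assms unfolding property_S_def by (metis half_gt_zero)
  define I where "I = {(C, D). C \<in> F \<and> D \<in> F \<and> C \<inter> D = {}}"
  have "I \<subseteq> F \<times> F" by (auto simp: I_def)
  then have "finite I" using F(1) by (meson finite_SigmaI finite_subset)
  have "\<forall>p\<in>I. \<exists>d>0. \<forall>x\<in>fst p. \<forall>y\<in>snd p. d \<le> dist x y"
    using C(1) by (auto simp: I_def intro!: separate_compact_closed compact_imp_closed)
  then obtain d where d: "\<And>p. p \<in> I \<Longrightarrow> d p > 0"
      "\<And>p x y. \<lbrakk>p \<in> I; x \<in> fst p; y \<in> snd p\<rbrakk> \<Longrightarrow> d p \<le> dist x y"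
    by metis
  show "\<exists>d>0. \<forall>x\<in>S. \<forall>y\<in>S. dist x y < d \<longrightarrow> (\<exists>C\<subseteq>S. connected C \<and> x \<in> C \<and> y \<in> C \<and> C \<subseteq> ball x e)"
  \<comment> \<open>The entry 1 keeps the minimum defined when no two pieces are disjoint.\<close>
  proof (intro exI[of _ "Min (insert 1 (d ` I))"] conjI ballI impI)
    show "Min (insert 1 (d ` I)) > 0" using d(1) \<open>finite I\<close> by simp
    fix x y assume xy: "x \<in> S" "y \<in> S" "dist x y < Min (insert 1 (d ` I))"
    then obtain A B where AB: "A \<in> F" "x \<in> A" "B \<in> F" "y \<in> B" using F by blast
    have "A \<inter> B \<noteq> {}"
    proof
      assume "A \<inter> B = {}"
      then have I: "(A, B) \<in> I" using AB by (simp add: I_def)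
      then have "d (A, B) \<le> dist x y" using d(2)[OF I] AB by simp
      moreover have "Min (insert 1 (d ` I)) \<le> d (A, B)" using I \<open>finite I\<close> by simp
      ultimately show False using xy by simp
    qed
    then obtain z where z: "z \<in> A" "z \<in> B" by blast
    have "A \<union> B \<subseteq> S" using AB F by blast
    moreover have "connected (A \<union> B)" using connected_Un[OF C(2) C(2)] AB \<open>A \<inter> B \<noteq> {}\<close> by blast
    moreover have "A \<union> B \<subseteq> ball x e"
    proof
      fix u assume "u \<in> A \<union> B"
      then show "u \<in> ball x e"
      proof
        assume "u \<in> A" then show ?thesis using C(3)[of A x u] AB \<open>e > 0\<close> by simp
      next
        assume "u \<in> B"
        then have "dist x z + dist z u < e" using C(3)[of A x z] C(3)[of B z u] AB z by simp
        then show ?thesis using dist_triangle[of x u z] by simp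
      qed
    qed
    ultimately show "\<exists>C\<subseteq>S. connected C \<and> x \<in> C \<and> y \<in> C \<and> C \<subseteq> ball x e"
      using AB by (intro exI[of _ "A \<union> B"]) auto
  qed
qed

section \<open>Property S of continuous images and finite unions\<close>

lemma property_S_continuous_image:
  fixes f :: "'a::metric_space \<Rightarrow> 'b::metric_space"
  assumes "compact S" "continuous_on S f" "property_S S"
  shows "property_S (f ` S)"
  unfolding property_S_def
proof (intro allI impI)
  fix e :: real assume "e > 0"
  then obtain d where d: "d > 0" "\<And>x y. \<lbrakk>x \<in> S; y \<in> S; dist y x < d\<rbrakk> \<Longrightarrow> dist (f y) (f x) < e"
    using compact_uniformly_continuous[OF assms(2,1)] unfolding uniformly_continuous_on_def by metis
  obtain F where F: "finite F" "\<Union>F = S"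
      "\<forall>C\<in>F. compact C \<and> connected C \<and> (\<forall>x\<in>C. \<forall>y\<in>C. dist x y < d)"
    using assms(3) d(1) unfolding property_S_def by metis
  have sub: "continuous_on C f" if "C \<in> F" for C
    using assms(2) F(2) that by (meson Union_upper continuous_on_subset)
  show "\<exists>G. finite G \<and> \<Union>G = f ` S \<and> (\<forall>C\<in>G. compact C \<and> connected C \<and> (\<forall>x\<in>C. \<forall>y\<in>C. dist x y < e))"
  proof (intro exI conjI ballI)
    show "finite ((`) f ` F)" "\<Union>((`) f ` F) = f ` S" using F by auto
    fix C assume "C \<in> (`) f ` F"
    then obtain D where D: "D \<in> F" "C = f ` D" by auto
    show "compact C" "connected C"
      using D F(3) sub by (auto intro: compact_continuous_image connected_continuous_image)
    show "dist x y < e" if xy: "x \<in> C" "y \<in> C" for x y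
    proof -
      obtain u v where uv: "u \<in> D" "v \<in> D" "x = f u" "y = f v" using xy D by auto
      then have "u \<in> S" "v \<in> S" "dist u v < d" using D F by auto
      then show ?thesis using d(2) uv by simp
    qed
  qed
qed

lemma property_S_UN:
  assumes "finite I" "\<And>i. i \<in> I \<Longrightarrow> property_S (S i)"
  shows "property_S (\<Union>i\<in>I. S i)"
  unfolding property_S_def
proof (intro allI impI)
  fix e :: real assume "e > 0"
  then have "\<forall>i\<in>I. \<exists>F. finite F \<and> \<Union>F = S i \<and>
        (\<forall>C\<in>F. compact C \<and> connected C \<and> (\<forall>x\<in>C. \<forall>y\<in>C. dist x y < e))"
    using assms(2) unfolding property_S_def by blast
  then obtain F where F: "\<forall>i\<in>I. finite (F i) \<and> \<Union>(F i) = S i \<and>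
        (\<forall>C\<in>F i. compact C \<and> connected C \<and> (\<forall>x\<in>C. \<forall>y\<in>C. dist x y < e))"
    by metis
  have "\<Union>(\<Union>i\<in>I. F i) = (\<Union>i\<in>I. \<Union>(F i))" by blast
  also have "\<dots> = (\<Union>i\<in>I. S i)" using F by simp
  finally show "\<exists>F. finite F \<and> \<Union>F = (\<Union>i\<in>I. S i) \<and>
        (\<forall>C\<in>F. compact C \<and> connected C \<and> (\<forall>x\<in>C. \<forall>y\<in>C. dist x y < e))"
    using assms(1) F by (intro exI[of _ "\<Union>i\<in>I. F i"]) simp
qed

section \<open>Intersections of sets with convex union\<close>

text \<open>A Urysohn function for \<open>P\<close> and \<open>Q\<close> yields a circle-valued map
  on \<open>A \<union> B\<close> that makes half a turn along \<open>A'\<close> and the opposite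
  half turn along \<open>B'\<close>. Convexity provides a continuous logarithm, which cannot change
  by both amounts between \<open>p\<close> and \<open>q\<close>.\<close>

lemma convex_Un_Int_not_separated:
  fixes A B :: "'a::euclidean_space set"
  assumes "convex (A \<union> B)" "closed A" "closed B"
    and PQ: "A \<inter> B = P \<union> Q" "closed P" "closed Q" "P \<inter> Q = {}"
    and A': "connected A'" "A' \<subseteq> A" "p \<in> A'" "q \<in> A'"
    and B': "connected B'" "B' \<subseteq> B" "p \<in> B'" "q \<in> B'"
    and "p \<in> P" "q \<in> Q"
  shows False
proof -
  obtain h :: "'a \<Rightarrow> real" where h: "continuous_on UNIV h" "\<And>x. x \<in> P \<Longrightarrow> h x = 0" "\<And>x. x \<in> Q \<Longrightarrow> h x = 1"
    using Urysohn_local[of UNIV P Q 0 1] PQ by (metis closed_closedin subtopology_UNIV)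
  \<comment> \<open>Along \<open>A'\<close> a logarithm of \<open>g\<close> gains \<open>\<i>\<pi>\<close> from \<open>p\<close> to \<open>q\<close>, along \<open>B'\<close> it loses \<open>\<i>\<pi>\<close>.\<close>
  define g where "g x = (if x \<in> A then exp (\<i> * of_real (pi * h x)) else exp (- (\<i> * of_real (pi * h x))))" for x
  have conth: "continuous_on C h" for C using h(1) continuous_on_subset by blast
  \<comment> \<open>On \<open>A \<inter> B\<close> the function \<open>h\<close> is 0 or 1, where
    the two exponentials agree, so the two formulas glue continuously.\<close>
  have gB: "g x = exp (- (\<i> * of_real (pi * h x)))" if "x \<in> B" for x
  proof (cases "x \<in> A")
    case True
    then have "x \<in> P \<or> x \<in> Q" using that PQ by blast
    then show ?thesis
      using h by (auto simp: g_def exp_minus)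
  qed (simp add: g_def)
  have "continuous_on A g"
    using continuous_on_cong[of A A g "\<lambda>x. exp (\<i> * of_real (pi * h x))"]
    by (auto simp: g_def intro!: continuous_intros conth)
  moreover have "continuous_on B g"
    using continuous_on_cong[of B B g "\<lambda>x. exp (- (\<i> * of_real (pi * h x)))"] gB
    by (auto intro!: continuous_intros conth)
  ultimately have "continuous_on (A \<union> B) g"
    using assms by (intro continuous_on_closed_Un)
  moreover have "g x \<noteq> 0" for x by (simp add: g_def)
  ultimately obtain l where l: "continuous_on (A \<union> B) l" "\<And>x. x \<in> A \<union> B \<Longrightarrow> g x = exp (l x)"
    using continuous_logarithm_on_contractible[of "A \<union> B" g] convex_imp_contractible[OF assms(1)]
    by metis
  \<comment> \<open>Both \<open>l\<close> and \<open>s * h\<close> are logarithms of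
    \<open>g\<close> on \<open>C\<close>; their difference has values in the discrete set of
    multiples of 2 pi i, hence is constant on the connected set \<open>C\<close>.\<close>
  have const: "l p - s * h p = l q - s * h q"
    if C: "connected C" "C \<subseteq> A \<union> B" "p \<in> C" "q \<in> C" and s: "\<And>x. x \<in> C \<Longrightarrow> g x = exp (s * h x)" for C and s :: complex
  proof -
    have one: "exp (l x - s * h x) = 1" if "x \<in> C" for x
      using l(2)[of x] s[OF that] that C(2) by (auto simp: exp_diff)
    have "(\<lambda>x. l x - s * h x) constant_on C"
    proof (rule continuous_discrete_range_constant[OF C(1)])
      show "continuous_on C (\<lambda>x. l x - s * h x)"
        using l(1) C(2) by (intro continuous_intros conth) (auto intro: continuous_on_subset)
      show "\<exists>e>0. \<forall>y. y \<in> C \<and> l y - s * h y \<noteq> l x - s * h x \<longrightarrow> e \<le> norm (l y - s * h y - (l x - s * h x))"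
        if "x \<in> C" for x
      proof (intro exI[of _ "2 * pi"] conjI allI impI)
        fix y assume y: "y \<in> C \<and> l y - s * h y \<noteq> l x - s * h x"
        have "exp (l y - s * h y - (l x - s * h x)) = 1"
          using one y \<open>x \<in> C\<close> by (simp add: exp_diff[of "l y - s * h y"])
        then obtain n :: int where re: "Re (l y - s * h y - (l x - s * h x)) = 0"
          and n: "Im (l y - s * h y - (l x - s * h x)) = of_int (2 * n) * pi"
          unfolding exp_eq_1 by blast
        have "n \<noteq> 0"
        proof
          assume "n = 0"
          then have "l y - s * h y - (l x - s * h x) = 0" using re n by (simp add: complex_eq_iff)
          then show False using y by simp
        qed
        then have "1 \<le> \<bar>real_of_int n\<bar>" by linarith
        then have "2 * pi \<le> \<bar>real_of_int (2 * n) * pi\<bar>" by (simp add: abs_mult)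
        also have "\<dots> \<le> norm (l y - s * h y - (l x - s * h x))"
          using abs_Im_le_cmod n by metis
        finally show "2 * pi \<le> norm (l y - s * h y - (l x - s * h x))" .
      qed simp
    qed
    then show ?thesis using C unfolding constant_on_def by metis
  qed
  have hp: "h p = 0" "h q = 1" using h assms by auto
  have "l p - (\<i> * pi) * h p = l q - (\<i> * pi) * h q"
    using A' by (intro const[of A']) (auto simp: g_def mult.assoc)
  moreover have "l p - (- (\<i> * pi)) * h p = l q - (- (\<i> * pi)) * h q"
    using B' by (intro const[of B']) (auto simp: gB mult.assoc)
  ultimately have "\<i> * complex_of_real pi = - (\<i> * complex_of_real pi)"
    using hp by (simp add: algebra_simps)
  then show False by (simp add: complex_eq_iff)
qed

text \<open>In a compact set a component is the intersection of its clopen neighbourhoods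
  (Sura-Bura), so points in different components would be separated as excluded above.\<close>

lemma connected_component_Int_convex_Un:
  fixes A B :: "'a::euclidean_space set"
  assumes conv: "convex (A \<union> B)" and A: "compact A" and B: "compact B"
    and "connected_component A p q" "connected_component B p q"
  shows "connected_component (A \<inter> B) p q"
proof (rule ccontr)
  assume neg: "\<not> connected_component (A \<inter> B) p q"
  obtain A' where A': "connected A'" "A' \<subseteq> A" "p \<in> A'" "q \<in> A'"
    using assms(4) by (auto simp: connected_component_def)
  obtain B' where B': "connected B'" "B' \<subseteq> B" "p \<in> B'" "q \<in> B'"
    using assms(5) by (auto simp: connected_component_def)
  let ?C = "connected_component_set (A \<inter> B) p"
  have cpt: "compact (A \<inter> B)" using A B by (rule compact_Int)
  have p: "p \<in> A \<inter> B" using A' B' by blast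
  then have C: "?C \<in> components (A \<inter> B)" by (auto simp: components_def)
  have "?C = \<Inter> {T. ?C \<subseteq> T \<and> openin (top_of_set (A \<inter> B)) T \<and> closedin (top_of_set (A \<inter> B)) T}"
    by (rule Sura_Bura_compact[OF cpt C])
  moreover have "q \<notin> ?C" using neg by simp
  ultimately obtain P where P: "?C \<subseteq> P" "openin (top_of_set (A \<inter> B)) P"
      "closedin (top_of_set (A \<inter> B)) P" "q \<notin> P"
    by blast
  define Q where "Q = A \<inter> B - P"
  have "closedin (top_of_set (A \<inter> B)) Q"
    using P(2) unfolding Q_def by (simp add: closedin_diff)
  then have "closed Q" using cpt closedin_closed_trans compact_imp_closed by blast
  moreover have "closed P" using P(3) cpt closedin_closed_trans compact_imp_closed by blast
  moreover have "A \<inter> B = P \<union> Q" using P(2) openin_imp_subset by (fastforce simp: Q_def)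
  moreover have "p \<in> P" using P(1) p connected_component_refl[OF p] by blast
  moreover have "q \<in> Q" using A' B' P(4) by (auto simp: Q_def)
  moreover have "P \<inter> Q = {}" by (auto simp: Q_def)
  ultimately show False
    using convex_Un_Int_not_separated[OF conv compact_imp_closed[OF A] compact_imp_closed[OF B] _ _ _ _ A' B']
    by metis
qed

section \<open>Sets tiled by injective images of themselves\<close>

text \<open>An unbounded component of \<open>- X\<close> that misses \<open>Y\<close> lies in one
  component of \<open>- Y\<close>, which is then unbounded too.\<close>

lemma outside_subset_outside:
  assumes "Y \<inter> outside X = {}"
  shows "outside X \<subseteq> outside Y"
proof
  fix z assume z: "z \<in> outside X"
  let ?Z = "connected_component_set (- X) z"
  have "?Z \<subseteq> outside X" using z outside_same_component by fastforce
  moreover have zZ: "z \<in> ?Z" using z by (simp add: outside_def)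
  ultimately have "?Z \<subseteq> connected_component_set (- Y) z"
    using assms by (intro connected_component_maximal) auto
  moreover have "z \<notin> Y" using z assms by blast
  ultimately show "z \<in> outside Y"
    using z bounded_subset by (auto simp: outside_def)
qed

text \<open>By invariance of domain, a bounded component of \<open>- T\<close> has an open image
  whose frontier lies in g(T). A component of the complement of g(T) meeting this image cannot leave
  it, so it is bounded.\<close>

lemma injective_image_Compl_outside:
  fixes g :: "'a::euclidean_space \<Rightarrow> 'a"
  assumes g: "continuous_on UNIV g" "inj g" and "closed T"
  shows "g ` (- outside T) \<subseteq> - outside (g ` T)"
proof (clarify)
  fix x assume x: "x \<notin> outside T" and out: "g x \<in> outside (g ` T)"
  then have gx: "g x \<notin> g ` T" using outside_no_overlap by blast
  let ?U = "connected_component_set (- T) x"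
  let ?Z = "connected_component_set (- g ` T) (g x)"
  have xT: "x \<notin> T" using gx by blast
  then have bU: "bounded ?U" using x by (simp add: outside_def)
  have cont: "continuous_on C g" for C using g(1) continuous_on_subset by blast
  have cpt: "compact (g ` closure ?U)"
    using bU by (intro compact_continuous_image cont) simp
  have openg: "open (g ` ?U)"
    using assms by (intro invariance_of_domain cont open_connected_component) (auto intro: inj_on_subset)
  have "?Z \<subseteq> g ` ?U"
  proof (rule ccontr)
    assume "\<not> ?Z \<subseteq> g ` ?U"
    then have "?Z \<inter> frontier (g ` ?U) \<noteq> {}"
    proof (intro connected_Int_frontier)
      have "g x \<in> ?Z" "x \<in> ?U" using gx xT by auto
      then show "?Z \<inter> g ` ?U \<noteq> {}" by blast
    qed auto
    then obtain z where z: "z \<in> ?Z" "z \<in> frontier (g ` ?U)" by blast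
    have "closure (g ` ?U) \<subseteq> g ` closure ?U"
      using cpt by (intro closure_minimal image_mono compact_imp_closed closure_subset)
    then obtain u where u: "z = g u" "u \<in> closure ?U" using z by (auto simp: frontier_def)
    have "z \<notin> g ` ?U" using z openg by (simp add: frontier_def interior_open)
    then have "u \<notin> ?U" using u by blast
    then have "u \<in> frontier ?U" using u(2) interior_subset by (fastforce simp: frontier_def)
    then have "u \<in> frontier (- T)" using frontier_of_connected_component_subset by blast
    then have "u \<in> T" using frontier_subset_closed[OF \<open>closed T\<close>] by (auto simp: frontier_complement)
    then have "z \<in> g ` T" using u by blast
    then show False using z connected_component_subset by blast
  qed
  then have "bounded ?Z"
    using compact_imp_bounded[OF cpt] closure_subset by (meson bounded_subset image_mono subset_trans)
  then show False using out by (simp add: outside_def)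
qed

text \<open>The descent is carried out as a choice of a tile whose filled hull is minimal among
  those inside the ball.\<close>

lemma connected_Compl_interior_tiled:
  fixes T :: "'a::euclidean_space set"
  assumes dim: "2 \<le> DIM('a)" and T: "compact T" "connected T" "T \<noteq> {}"
    and \<Phi>: "finite \<Phi>" "\<And>g. g \<in> \<Phi> \<Longrightarrow> continuous_on UNIV g" "\<And>g. g \<in> \<Phi> \<Longrightarrow> inj g"
    and tiles: "T = (\<Union>g\<in>\<Phi>. g ` T)"
    and disj: "\<And>g h. \<lbrakk>g \<in> \<Phi>; h \<in> \<Phi>; g \<noteq> h\<rbrakk> \<Longrightarrow> g ` interior T \<inter> h ` T = {}"
    and w: "ball x r \<subseteq> T" "w \<in> \<Phi>" "w ` T \<subseteq> ball x r"
  shows "connected (- interior T)"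
proof (rule ccontr)
  assume "\<not> connected (- interior T)"
  then obtain E0 F0 where EF0: "closed E0" "closed F0" "E0 \<noteq> {}" "F0 \<noteq> {}" "E0 \<union> F0 = - interior T" "E0 \<inter> F0 = {}"
    by (subst (asm) connected_closed_set) auto
  obtain R where R: "T \<subseteq> ball 0 R" using compact_imp_bounded[OF T(1)] bounded_subset_ballD by blast
  have conR: "connected (- ball (0::'a) R)"
    using dim by (intro connected_complement_bounded_convex) auto
  have subR: "- ball 0 R \<subseteq> E0 \<union> F0" using R interior_subset EF0(5) by blast
  \<comment> \<open>In dimension at least 2 the exterior of a large ball is connected, so one of the
    two parts is bounded.\<close>
  have "- ball 0 R \<inter> E0 = {} \<or> - ball 0 R \<inter> F0 = {}"
    using connected_closedD[OF conR, of E0 F0] EF0 subR by blast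
  then obtain E F where EF: "closed E" "closed F" "E \<noteq> {}" "E \<union> F = - interior T" "E \<inter> F = {}" "E \<subseteq> ball 0 R"
  proof
    assume "- ball 0 R \<inter> E0 = {}" then show thesis using that[of E0 F0] EF0 by blast
  next
    assume "- ball 0 R \<inter> F0 = {}" then show thesis using that[of F0 E0] EF0 by blast
  qed
  have Ecpt: "compact E" using EF(1,6) by (meson bounded_ball bounded_subset compact_eq_bounded_closed)
  have FE: "- F = E \<union> interior T" using EF(4,5) by blast
  have opF: "open (- F)" using EF(2) by auto
  \<comment> \<open>A component of \<open>- T\<close> that meets \<open>E\<close> cannot reach
    \<open>F\<close>, so it stays in the bounded set \<open>E\<close>.\<close>
  have E_hull: "E \<subseteq> - outside T"
  proof (clarify)
    fix y assume y: "y \<in> E" "y \<in> outside T"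
    let ?U = "connected_component_set (- T) y"
    have "?U \<subseteq> - T" by (rule connected_component_subset)
    then have "?U \<subseteq> E \<union> F" using EF(4) interior_subset by blast
    moreover have "y \<in> ?U" using y by (simp add: outside_def)
    ultimately have "?U \<inter> F = {}"
      using connected_closedD[of ?U E F] EF y by fastforce
    then have "?U \<subseteq> ball 0 R" using \<open>?U \<subseteq> E \<union> F\<close> EF(6) by blast
    then show False using y bounded_subset[OF bounded_ball] by (auto simp: outside_def)
  qed
  have F_hull: "- F \<subseteq> - outside T"
    using FE E_hull interior_subset[of T] outside_no_overlap[of T] by blast
  \<comment> \<open>\<open>H g\<close> is the tile \<open>g ` T\<close> with its holes filled.\<close>
  define H where "H g = - outside (g ` T)" for g :: "'a \<Rightarrow> 'a"
  \<comment> \<open>A hull inside the ball lies in \<open>T\<close>, so the copies of the holes in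
    it are covered by tiles again.\<close>
  define \<Psi> where "\<Psi> = {g \<in> \<Phi>. H g \<subseteq> ball x r}"
  have cont: "continuous_on C g" if "g \<in> \<Phi>" for g C using \<Phi>(2)[OF that] continuous_on_subset by blast
  have "outside (ball x r) \<subseteq> outside (w ` T)" by (rule outside_mono[OF w(3)])
  then have "w \<in> \<Psi>" using w(2) by (auto simp: \<Psi>_def H_def outside_convex)
  moreover have "finite \<Psi>" using \<Phi>(1) by (simp add: \<Psi>_def)
  ultimately obtain g where g: "g \<in> \<Psi>" and min: "\<And>h. \<lbrakk>h \<in> \<Psi>; H h \<subseteq> H g\<rbrakk> \<Longrightarrow> H h = H g"
    using finite_has_minimal[of "H ` \<Psi>"] by blast
  have g\<Phi>: "g \<in> \<Phi>" using g by (simp add: \<Psi>_def)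
  have "E \<inter> - T \<noteq> {}"
  proof -
    obtain e where e: "e \<in> E" using EF(3) by blast
    then have "e \<in> closure (- T)" using EF(4) by (auto simp: closure_complement)
    moreover have "e \<in> - F" using e EF(5) by blast
    ultimately obtain e' where "e' \<in> - F" "e' \<in> - T"
      using opF by (meson closure_iff_nhds_not_empty disjoint_iff subset_refl)
    then show ?thesis using FE interior_subset by blast
  qed
  then obtain e where e: "e \<in> E" "e \<notin> T" by blast
  have gH: "g ` (- outside T) \<subseteq> H g"
    unfolding H_def using g\<Phi> \<Phi> T by (intro injective_image_Compl_outside) (auto simp: compact_imp_closed)
  have "g e \<in> T" using gH E_hull e(1) g w(1) unfolding \<Psi>_def by blast
  then obtain h where h: "h \<in> \<Phi>" "g e \<in> h ` T" using tiles by blast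
  have "g e \<notin> g ` T" using e(2) \<Phi>(3)[OF g\<Phi>] by (auto dest: injD)
  then have "g \<noteq> h" using h by blast
  have opgF: "open (g ` (- F))"
    using \<Phi>(3)[OF g\<Phi>] by (intro invariance_of_domain cont g\<Phi> opF) (auto intro: inj_on_subset)
  have gE: "closed (g ` E)"
    using Ecpt by (intro compact_imp_closed compact_continuous_image cont g\<Phi>)
  \<comment> \<open>The tile h(T) avoids g(interior T), the only part of the open set g(- F) beyond
    g(E). Being connected and meeting the closed set g(E), it cannot reach the complement of g(-
    F).\<close>
  have hE: "h ` T \<subseteq> g ` E"
  proof -
    have sub: "h ` T \<subseteq> g ` E \<union> - g ` (- F)"
      using disj[OF g\<Phi> h(1) \<open>g \<noteq> h\<close>] FE by auto
    have "connected (h ` T)" using T h cont by (intro connected_continuous_image) auto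
    moreover have "g ` E \<subseteq> g ` (- F)" using FE by blast
    ultimately have "g ` E \<inter> h ` T = {} \<or> - g ` (- F) \<inter> h ` T = {}"
      using connected_closedD[of "h ` T" "g ` E" "- g ` (- F)"] sub gE opgF by (auto simp: closed_Compl)
    then show ?thesis using sub h e by blast
  qed
  have EH: "- outside (g ` E) \<subseteq> H g"
  proof -
    have "g ` E \<inter> outside (g ` T) = {}" using gH E_hull unfolding H_def by blast
    then show ?thesis using outside_subset_outside unfolding H_def by blast
  qed
  have hH: "H h \<subseteq> - outside (g ` E)" using outside_mono[OF hE] by (auto simp: H_def)
  then have "H h \<subseteq> H g" using EH by blast
  moreover have "h \<in> \<Psi>" using h(1) \<open>H h \<subseteq> H g\<close> g by (auto simp: \<Psi>_def)
  ultimately have "H h = H g" using min by blast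
  \<comment> \<open>So g(E) and g(T) have the same hull. A frontier point of the outside of g(E)
    lies in g(E), hence in the open set g(- F), which this hull contains; such a point cannot be in
    the closure of the outside.\<close>
  then have eq: "outside (g ` E) = outside (g ` T)" using EH hH by (auto simp: H_def)
  have "bounded (g ` E)" using Ecpt g\<Phi> cont by (intro compact_imp_bounded compact_continuous_image) auto
  then have "outside (g ` E) \<noteq> {}" using outside_bounded_nonempty by blast
  moreover have "outside (g ` E) \<noteq> UNIV" using EF(3) outside_no_overlap[of "g ` E"] by blast
  ultimately obtain z where z: "z \<in> frontier (outside (g ` E))" using frontier_eq_empty by blast
  then have "z \<in> g ` E" using frontier_outside_subset[OF gE] by blast
  then have "z \<in> g ` (- F)" using FE by blast
  moreover have "g ` (- F) \<inter> outside (g ` E) = {}" using gH F_hull eq unfolding H_def by blast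
  ultimately have "z \<notin> closure (outside (g ` E))" using opgF
    by (metis closure_iff_nhds_not_empty inf_commute subset_refl)
  then show False using z by (simp add: frontier_def)
qed

text \<open>Local connectedness is proved for the copy \<open>X\<close> of the frontier, around
  which whole balls are covered by \<open>A\<close> and \<open>K\<close>; \<open>inv w\<close> then
  carries path connectedness back.\<close>

lemma path_connected_frontier_tiled:
  fixes T :: "'a::euclidean_space set"
  assumes dim: "2 \<le> DIM('a)" and T: "compact T" "connected T" "T \<noteq> {}" "property_S T"
    and \<Phi>: "finite \<Phi>" "\<And>g. g \<in> \<Phi> \<Longrightarrow> continuous_on UNIV g" "\<And>g. g \<in> \<Phi> \<Longrightarrow> inj g"
    and tiles: "T = (\<Union>g\<in>\<Phi>. g ` T)"
    and disj: "\<And>g h. \<lbrakk>g \<in> \<Phi>; h \<in> \<Phi>; g \<noteq> h\<rbrakk> \<Longrightarrow> g ` interior T \<inter> h ` T = {}"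
    and w: "ball x r \<subseteq> T" "w \<in> \<Phi>" "w ` T \<subseteq> ball x r"
  shows "path_connected (frontier T)"
proof -
  have "closed T" using T by (simp add: compact_imp_closed)
  have fr: "frontier T = T \<inter> - interior T"
    using \<open>closed T\<close> by (auto simp: frontier_def)
  have cont: "continuous_on C g" if "g \<in> \<Phi>" for g C using \<Phi>(2)[OF that] continuous_on_subset by blast
  have "connected (- interior T)"
    by (rule connected_Compl_interior_tiled[OF dim T(1-3) \<Phi> tiles disj w])
  then have con: "connected (frontier T)"
    unfolding fr using unicoherentD[OF convex_imp_unicoherent[OF convex_UNIV], of T "- interior T"] T(2) \<open>closed T\<close>
      interior_subset[of T] by (auto simp: closed_Compl)
  define A where "A = w ` T"
  define K where "K = (\<Union>g\<in>\<Phi> - {w}. g ` T)"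
  define X where "X = w ` frontier T"
  have pieces: "compact (g ` T)" "property_S (g ` T)" if "g \<in> \<Phi>" for g
    using that T cont by (auto intro: compact_continuous_image property_S_continuous_image)
  have cA: "compact A" and ulcA: "uniformly_locally_connected A"
    unfolding A_def using pieces[OF w(2)] property_S_imp_ulc by auto
  have cK: "compact K" and ulcK: "uniformly_locally_connected K"
    unfolding K_def using pieces \<Phi>(1) by (auto intro!: compact_UN property_S_imp_ulc property_S_UN)
  have AK: "A \<union> K = T"
  proof -
    have "(\<Union>g\<in>\<Phi>. g ` T) = A \<union> K" using w(2) by (auto simp: A_def K_def)
    then show ?thesis using tiles by simp
  qed
  have X: "X = A \<inter> K"
  proof
    show "X \<subseteq> A \<inter> K"
    proof
      fix y assume "y \<in> X"
      then obtain t where t: "t \<in> frontier T" "y = w t" by (auto simp: X_def)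
      have "t \<in> T" using t fr by blast
      then have yA: "y \<in> A" using t by (simp add: A_def)
      moreover have "y \<in> K"
      proof (rule ccontr)
        assume "y \<notin> K"
        \<comment> \<open>The ball is covered by \<open>A\<close> and \<open>K\<close>, so by
          injectivity of \<open>w\<close> this open preimage lies in \<open>T\<close> and would make
          \<open>t\<close> an interior point.\<close>
        let ?N = "w -` (ball x r - K)"
        have "open ?N"
          using cK by (intro open_vimage open_Diff open_ball compact_imp_closed \<Phi>(2) w(2))
        moreover have "?N \<subseteq> T"
        proof
          fix z assume z: "z \<in> ?N"
          then have "w z \<in> A" using w(1) AK by blast
          then show "z \<in> T" using \<Phi>(3)[OF w(2)] by (auto simp: A_def dest: injD)
        qed
        moreover have "t \<in> ?N" using yA w(3) \<open>y \<notin> K\<close> t by (auto simp: A_def)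
        ultimately have "t \<in> interior T" by (meson interiorI)
        then show False using t fr by blast
      qed
      ultimately show "y \<in> A \<inter> K" by blast
    qed
    show "A \<inter> K \<subseteq> X"
    proof
      fix y assume y: "y \<in> A \<inter> K"
      then obtain t g where t: "t \<in> T" "y = w t" and g: "g \<in> \<Phi>" "w \<noteq> g" "y \<in> g ` T"
        by (auto simp: A_def K_def)
      then have "t \<notin> interior T" using disj[OF w(2) g(1,2)] by blast
      then show "y \<in> X" using t fr by (auto simp: X_def)
    qed
  qed
  have cX: "compact X" unfolding X using cA cK by (rule compact_Int)
  have "X \<subseteq> ball x r" using X w(3) by (auto simp: A_def)
  then obtain \<rho> where \<rho>: "\<rho> > 0" "(\<Union>p\<in>X. cball p \<rho>) \<subseteq> ball x r"
    using compact_subset_open_imp_cball_epsilon_subset[OF cX open_ball] by blast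
  have "uniformly_locally_connected X"
    unfolding uniformly_locally_connected_def
  proof (intro allI impI)
    fix e :: real assume "e > 0"
    \<comment> \<open>The bound \<open>\<rho>\<close> keeps closed balls inside
      \<open>A \<union> K\<close>, so that cutting \<open>A\<close> and \<open>K\<close> with them
      gives a convex union; \<open>e/2\<close> fits them into the open ball of radius
      \<open>e\<close>.\<close>
    define e' where "e' = min (e/2) \<rho>"
    have e': "e' > 0" "e' < e" "e' \<le> \<rho>" using \<open>e > 0\<close> \<rho>(1) by (auto simp: e'_def)
    obtain d1 where d1: "d1 > 0" "\<And>p q. \<lbrakk>p \<in> A; q \<in> A; dist p q < d1\<rbrakk> \<Longrightarrow>
        \<exists>C\<subseteq>A. connected C \<and> p \<in> C \<and> q \<in> C \<and> C \<subseteq> ball p e'"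
      using ulcA e'(1) unfolding uniformly_locally_connected_def by metis
    obtain d2 where d2: "d2 > 0" "\<And>p q. \<lbrakk>p \<in> K; q \<in> K; dist p q < d2\<rbrakk> \<Longrightarrow>
        \<exists>C\<subseteq>K. connected C \<and> p \<in> C \<and> q \<in> C \<and> C \<subseteq> ball p e'"
      using ulcK e'(1) unfolding uniformly_locally_connected_def by metis
    have "\<exists>C\<subseteq>X. connected C \<and> p \<in> C \<and> q \<in> C \<and> C \<subseteq> ball p e"
      if pq: "p \<in> X" "q \<in> X" "dist p q < min d1 d2" for p q
    proof -
      let ?B = "cball p e'"
      have "?B \<subseteq> cball p \<rho>" using e'(3) by (simp add: subset_cball)
      then have "?B \<subseteq> A \<union> K" using \<rho>(2) pq(1) w(1) AK by blast
      then have B: "A \<inter> ?B \<union> K \<inter> ?B = ?B" by blast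
      obtain A' where A': "A' \<subseteq> A" "connected A'" "p \<in> A'" "q \<in> A'" "A' \<subseteq> ball p e'"
        using d1(2)[of p q] pq X by auto
      obtain K' where K': "K' \<subseteq> K" "connected K'" "p \<in> K'" "q \<in> K'" "K' \<subseteq> ball p e'"
        using d2(2)[of p q] pq X by auto
      have "A' \<subseteq> A \<inter> ?B" "K' \<subseteq> K \<inter> ?B" using A' K' ball_subset_cball by blast+
      then have "connected_component (A \<inter> ?B) p q" "connected_component (K \<inter> ?B) p q"
        using A' K' unfolding connected_component_def by blast+
      then have "connected_component ((A \<inter> ?B) \<inter> (K \<inter> ?B)) p q"
        using cA cK by (intro connected_component_Int_convex_Un[of "A \<inter> ?B" "K \<inter> ?B"]) (simp_all only: B convex_cball compact_Int compact_cball)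
      then obtain C where C: "connected C" "C \<subseteq> (A \<inter> ?B) \<inter> (K \<inter> ?B)" "p \<in> C" "q \<in> C"
        unfolding connected_component_def by blast
      have "?B \<subseteq> ball p e" using e'(2) by (simp add: subset_iff)
      then have "C \<subseteq> X" "C \<subseteq> ball p e" using C(2) X by blast+
      then show ?thesis using C by blast
    qed
    then show "\<exists>d>0. \<forall>p\<in>X. \<forall>q\<in>X. dist p q < d \<longrightarrow>
        (\<exists>C\<subseteq>X. connected C \<and> p \<in> C \<and> q \<in> C \<and> C \<subseteq> ball p e)"
      using d1(1) d2(1) by (intro exI[of _ "min d1 d2"]) auto
  qed
  moreover have "connected X"
    unfolding X_def using con cont w(2) by (intro connected_continuous_image) auto
  ultimately have "path_connected X"
    using cX by (intro complete_ulc_imp_path_connected compact_imp_complete)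
  moreover have "continuous_on X (inv w)"
    unfolding X_def using T(1) \<Phi>(3)[OF w(2)] cont[OF w(2)]
    by (intro continuous_on_inv) (auto simp: compact_frontier)
  ultimately have "path_connected (inv w ` X)" by (rule path_connected_continuous_image[rotated])
  then show ?thesis using \<Phi>(3)[OF w(2)] by (simp add: X_def image_comp)
qed

section \<open>Iterated function systems\<close>

text \<open>Compositions form a set of maps rather than a family indexed by words, so distinct tiles
  come from unequal maps.\<close>

primrec iterates :: "('a \<Rightarrow> 'a) set \<Rightarrow> nat \<Rightarrow> ('a \<Rightarrow> 'a) set" where
  "iterates F 0 = {id}"
| "iterates F (Suc n) = (\<lambda>(f, g). f \<circ> g) ` (F \<times> iterates F n)"

section \<open>Elementary properties of iterates\<close>

lemma finite_iterates: "finite F \<Longrightarrow> finite (iterates F n)"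
  by (induction n) simp_all

lemma inj_iterates:
  assumes "\<And>f. f \<in> F \<Longrightarrow> inj f" "g \<in> iterates F n"
  shows "inj g"
  using assms(2) by (induction n arbitrary: g) (auto simp: assms(1) intro!: inj_compose)

lemma iterates_image_subset:
  assumes "\<And>f. f \<in> F \<Longrightarrow> f ` V \<subseteq> V" "g \<in> iterates F n"
  shows "g ` V \<subseteq> V"
  using assms(2)
proof (induction n arbitrary: g)
  case (Suc n)
  then show ?case using assms(1) by (fastforce simp: image_subset_iff)
qed simp

lemma iterates_cover:
  assumes "T = (\<Union>f\<in>F. f ` T)"
  shows "T = (\<Union>g\<in>iterates F n. g ` T)"
proof (induction n)
  case (Suc n)
  have "(\<Union>g\<in>iterates F (Suc n). g ` T) = (\<Union>f\<in>F. f ` (\<Union>g\<in>iterates F n. g ` T))"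
    by force
  also have "\<dots> = T" by (simp only: Suc[symmetric] assms[symmetric])
  finally show ?case by (rule sym)
qed simp

lemma iterates_lipschitz:
  fixes F :: "('a::metric_space \<Rightarrow> 'a) set"
  assumes "\<And>f x y. f \<in> F \<Longrightarrow> dist (f x) (f y) \<le> c * dist x y" "0 \<le> c" "g \<in> iterates F n"
  shows "dist (g x) (g y) \<le> c ^ n * dist x y"
  using assms(3)
proof (induction n arbitrary: g)
  case (Suc n)
  then obtain f h where "f \<in> F" "h \<in> iterates F n" "g = f \<circ> h" by auto
  then have "dist (g x) (g y) \<le> c * dist (h x) (h y)" "dist (h x) (h y) \<le> c ^ n * dist x y"
    using assms(1) Suc by auto
  then show ?case
    using mult_left_mono[of "dist (h x) (h y)" "c ^ n * dist x y" c] assms(2) by (simp add: mult.assoc)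
qed simp

text \<open>Compare the outermost maps: if equal, injectivity reduces to the previous level; if not,
  their images of \<open>V\<close> are already disjoint.\<close>

lemma iterates_disjoint:
  assumes "\<And>f. f \<in> F \<Longrightarrow> inj f" "\<And>f. f \<in> F \<Longrightarrow> f ` V \<subseteq> V"
    and "\<And>f f'. \<lbrakk>f \<in> F; f' \<in> F; f \<noteq> f'\<rbrakk> \<Longrightarrow> f ` V \<inter> f' ` V = {}"
    and "g \<in> iterates F n" "h \<in> iterates F n" "g \<noteq> h"
  shows "g ` V \<inter> h ` V = {}"
  using assms(4-6)
proof (induction n arbitrary: g h)
  case (Suc n)
  obtain f g' where g: "f \<in> F" "g' \<in> iterates F n" "g = f \<circ> g'" using Suc.prems by auto
  obtain f' h' where h: "f' \<in> F" "h' \<in> iterates F n" "h = f' \<circ> h'" using Suc.prems by auto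
  have sub: "g' ` V \<subseteq> V" "h' ` V \<subseteq> V" using iterates_image_subset[OF assms(2)] g h by metis+
  show ?case
  proof (cases "f = f'")
    case True
    then have "g' ` V \<inter> h' ` V = {}" using Suc g h by blast
    then have "f ` (g' ` V) \<inter> f ` (h' ` V) = {}"
      using assms(1)[OF g(1)] by (simp add: image_Int[symmetric])
    then show ?thesis using True g h by (simp add: image_comp)
  next
    case False
    then have "f ` V \<inter> f' ` V = {}" using assms(3) g h by blast
    then show ?thesis using sub g h by (simp only: image_comp[symmetric]) blast
  qed
qed simp

lemma iterates_small:
  fixes F :: "('a::metric_space \<Rightarrow> 'a) set"
  assumes lip: "\<And>f x y. f \<in> F \<Longrightarrow> dist (f x) (f y) \<le> c * dist x y" "0 \<le> c" "c < 1"
    and "bounded B" "e > 0"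
  obtains n where "\<And>g x y. \<lbrakk>g \<in> iterates F n; x \<in> B; y \<in> B\<rbrakk> \<Longrightarrow> dist (g x) (g y) < e"
proof -
  \<comment> \<open>Adding 1 keeps the divisor positive.\<close>
  define D where "D = diameter B + 1"
  have D: "D > 0" using diameter_ge_0[OF assms(4)] by (simp add: D_def)
  obtain n where n: "c ^ n < e / D" using real_arch_pow_inv[of "e / D" c] assms D by auto
  show thesis
  proof (rule that)
    fix g x y assume g: "g \<in> iterates F n" "x \<in> B" "y \<in> B"
    have "dist (g x) (g y) \<le> c ^ n * dist x y" using iterates_lipschitz[OF lip(1,2) g(1)] by blast
    also have "\<dots> \<le> c ^ n * D"
      using diameter_bounded_bound[OF assms(4) g(2,3)] assms(2) by (intro mult_left_mono) (auto simp: D_def)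
    also have "\<dots> < e" using n D by (simp add: field_simps)
    finally show "dist (g x) (g y) < e" .
  qed
qed

text \<open>For nonempty interior, the tiles are those of one level fine enough to fit a tile into a
  ball in \<open>T\<close>.\<close>

lemma path_connected_frontier_attractor:
  fixes T :: "'a::euclidean_space set"
  assumes dim: "2 \<le> DIM('a)"
    and F: "finite F" "\<And>f. f \<in> F \<Longrightarrow> inj f"
    and lip: "\<And>f x y. f \<in> F \<Longrightarrow> dist (f x) (f y) \<le> c * dist x y" "0 \<le> c" "c < 1"
    and V: "open V" "V \<noteq> {}" "\<And>f. f \<in> F \<Longrightarrow> f ` V \<subseteq> V"
      "\<And>f g. \<lbrakk>f \<in> F; g \<in> F; f \<noteq> g\<rbrakk> \<Longrightarrow> f ` V \<inter> g ` V = {}"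
    and T: "compact T" "connected T" "T \<noteq> {}" "T = (\<Union>f\<in>F. f ` T)"
  shows "path_connected (frontier T)"
proof -
  have cover: "T = (\<Union>g\<in>iterates F n. g ` T)" for n by (rule iterates_cover[OF T(4)])
  have bT: "bounded (insert z T)" for z using T(1) compact_imp_bounded by simp
  \<comment> \<open>The extra point \<open>z\<close> allows comparison with points outside
    \<open>T\<close>, such as points of \<open>V\<close>.\<close>
  have small: "\<exists>n. \<forall>g\<in>iterates F n. \<forall>x\<in>insert z T. \<forall>y\<in>insert z T. dist (g x) (g y) < e" if e: "e > 0" for e z
    using iterates_small[OF lip bT[of z] e] by metis
  have cont: "continuous_on C g" if "g \<in> iterates F n" for g n C
  proof -
    have "(c ^ n)-lipschitz_on C g"
      using iterates_lipschitz[OF lip(1,2) that] lip(2) by (intro lipschitz_onI) auto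
    then show ?thesis by (rule lipschitz_on_continuous_on)
  qed
  have inj: "inj g" if "g \<in> iterates F n" for g n using inj_iterates[OF F(2) that] .
  have opn: "open (g ` U)" if "g \<in> iterates F n" "open U" for g n U
    using that by (intro invariance_of_domain cont) (auto intro: inj_on_subset[OF inj])
  have propS: "property_S T"
    unfolding property_S_def
  proof (intro allI impI)
    fix e :: real assume "e > 0"
    obtain z where "z \<in> T" using T(3) by blast
    obtain n where n: "\<forall>g\<in>iterates F n. \<forall>x\<in>insert z T. \<forall>y\<in>insert z T. dist (g x) (g y) < e"
      using small[OF \<open>e > 0\<close>] by blast
    have "finite ((\<lambda>g. g ` T) ` iterates F n)" using finite_iterates[OF F(1)] by blast
    moreover have "\<Union>((\<lambda>g. g ` T) ` iterates F n) = T" using cover by simp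
    moreover have "\<forall>C\<in>(\<lambda>g. g ` T) ` iterates F n.
        compact C \<and> connected C \<and> (\<forall>x\<in>C. \<forall>y\<in>C. dist x y < e)"
      using T(1,2) n by (auto intro: compact_continuous_image connected_continuous_image cont)
    ultimately show "\<exists>G. finite G \<and> \<Union>G = T \<and>
        (\<forall>C\<in>G. compact C \<and> connected C \<and> (\<forall>x\<in>C. \<forall>y\<in>C. dist x y < e))"
      by blast
  qed
  show ?thesis
  proof (cases "interior T = {}")
    case True
    then have "frontier T = T" using T(1) by (simp add: frontier_def compact_imp_closed)
    then show ?thesis
      using complete_ulc_imp_path_connected[OF compact_imp_complete[OF T(1)] T(2) property_S_imp_ulc[OF propS]]
      by simp
  next
    case False
    \<comment> \<open>The small tile containing \<open>t\<close> is the image of \<open>T\<close>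
      under some \<open>g\<close>, and this \<open>g\<close> sends any point of the invariant set
      \<open>U\<close> close to \<open>t\<close>.\<close>
    have dense: "T \<subseteq> closure U" if U: "U \<noteq> {}" "\<And>n g. g \<in> iterates F n \<Longrightarrow> g ` U \<subseteq> U" for U
    proof
      fix t assume t: "t \<in> T"
      obtain z where z: "z \<in> U" using U(1) by blast
      show "t \<in> closure U"
        unfolding closure_approachable
      proof (intro allI impI)
        fix e :: real assume "e > 0"
        then obtain n where n: "\<forall>g\<in>iterates F n. \<forall>x\<in>insert z T. \<forall>y\<in>insert z T. dist (g x) (g y) < e"
          using small by blast
        obtain g s where g: "g \<in> iterates F n" "s \<in> T" "t = g s" using t cover[of n] by blast
        then have "dist (g z) t < e" "g z \<in> U" using n z U(2)[OF g(1)] by auto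
        then show "\<exists>y\<in>U. dist y t < e" by blast
      qed
    qed
    have intT: "T \<subseteq> closure (interior T)"
    proof (rule dense[OF False])
      fix n g assume g: "g \<in> iterates F n"
      have "g ` interior T \<subseteq> T" using cover[of n] g interior_subset by blast
      then show "g ` interior T \<subseteq> interior T" using opn[OF g] by (simp add: interior_maximal)
    qed
    have TV: "T \<subseteq> closure V" using dense[OF V(2)] iterates_image_subset[OF V(3)] by blast
    have meet: "\<exists>z\<in>D. g z \<in> W" if "g \<in> iterates F n" "open W" "t \<in> closure D" "g t \<in> W" for g n W t D
    proof -
      have "open (g -` W)" using that cont by (intro open_vimage) auto
      then show ?thesis using that by (auto simp: closure_iff_nhds_not_empty)
    qed
    \<comment> \<open>Disjointness is known only for images of \<open>V\<close>. A common point is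
      perturbed within open sets: first on the side of \<open>h\<close> into
      \<open>interior T\<close>, then on the side of \<open>g\<close> into \<open>V\<close>, finally
      on the side of \<open>h\<close> into \<open>V\<close>.\<close>
    have disj: "g ` interior T \<inter> h ` T = {}"
      if gh: "g \<in> iterates F n" "h \<in> iterates F n" "g \<noteq> h" for g h n
    proof (rule ccontr)
      assume "g ` interior T \<inter> h ` T \<noteq> {}"
      then obtain y where y: "y \<in> g ` interior T" "y \<in> h ` T" by blast
      then obtain t where t: "t \<in> T" "h t \<in> g ` interior T" by (elim imageE[of y h]) simp
      have "open (g ` interior T)" using opn gh by blast
      then obtain a b where ab: "a \<in> interior T" "b \<in> interior T" "h a = g b"
        using meet[OF gh(2) _ _ t(2), of "interior T"] t(1) intT by (metis imageE subset_iff)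
      have "a \<in> T" "b \<in> T" using ab interior_subset by blast+
      then have clV: "b \<in> closure V" using TV by blast
      have "open (h ` interior T)" using opn gh by blast
      moreover have "g b \<in> h ` interior T" using ab by (metis imageI)
      ultimately obtain b' where b': "b' \<in> V" "g b' \<in> h ` interior T"
        using meet[OF gh(1) _ clV] by blast
      then obtain a' where a': "a' \<in> interior T" "g b' = h a'" by blast
      then have "a' \<in> closure V" using TV interior_subset by blast
      moreover have "open (g ` V)" using opn gh V(1) by blast
      moreover have "h a' \<in> g ` V" using a' b' by (metis imageI)
      ultimately obtain a'' where "a'' \<in> V" "h a'' \<in> g ` V"
        using meet[OF gh(2)] by blast
      then show False using iterates_disjoint[OF F(2) V(3,4) gh] by blast
    qed
    obtain x where x: "x \<in> interior T" using False by blast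
    then obtain r where r: "r > 0" "ball x r \<subseteq> T" by (auto simp: mem_interior)
    obtain n where n: "\<forall>g\<in>iterates F n. \<forall>y\<in>insert x T. \<forall>z\<in>insert x T. dist (g y) (g z) < r"
      using small[OF r(1)] by blast
    have "x \<in> T" using x interior_subset by blast
    then obtain w s where w: "w \<in> iterates F n" "s \<in> T" "x = w s" using cover[of n] by blast
    then have wT: "w ` T \<subseteq> ball x r" using n by auto
    show ?thesis
      by (rule path_connected_frontier_tiled[OF dim T(1-3) propS finite_iterates[OF F(1)] cont inj cover disj r(2) w(1) wT])
  qed
qed

theorem theorem1p1:
  fixes m :: nat and f :: "nat \<Rightarrow> plane \<Rightarrow> plane" and T :: "plane set"
  assumes "m \<ge> 1"
    and "\<And>i. i \<in> {1..m} \<Longrightarrow> inj (f i)"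
    and "\<And>i. i \<in> {1..m} \<Longrightarrow> contraction (f i)"
    and "open_set_condition m f"
    and "T \<noteq> {}" and "compact T"
    and "T = (\<Union>i\<in>{1..m}. f i ` T)"
    and "connected T"
  shows "arcwise_connected (frontier T)"
proof -
  have "\<exists>c<1. \<forall>x y. dist (f i x) (f i y) \<le> c * dist x y" if i: "i \<in> {1..m}" for i
  proof -
    obtain c where c: "c < 1" "\<And>x y. x \<noteq> y \<Longrightarrow> dist (f i x) (f i y) / dist x y \<le> c"
      using assms(3)[OF i] unfolding contraction_def by blast
    have "dist (f i x) (f i y) \<le> c * dist x y" for x y
      using c(2)[of x y] by (cases "x = y") (auto simp: pos_divide_le_eq)
    then show ?thesis using c(1) by blast
  qed
  then obtain c where c: "\<And>i. i \<in> {1..m} \<Longrightarrow> c i < 1"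
      "\<And>i x y. i \<in> {1..m} \<Longrightarrow> dist (f i x) (f i y) \<le> c i * dist x y"
    by metis
  \<comment> \<open>A common ratio for all maps; the entry 0 makes it nonnegative.\<close>
  define C where "C = Max (insert 0 (c ` {1..m}))"
  have C: "0 \<le> C" "C < 1" "\<And>i. i \<in> {1..m} \<Longrightarrow> c i \<le> C"
    unfolding C_def using c(1) by (auto intro!: Max_ge simp del: Max_insert)
  have lip: "dist (g x) (g y) \<le> C * dist x y" if "g \<in> f ` {1..m}" for g x y
  proof -
    obtain i where i: "i \<in> {1..m}" "g = f i" using \<open>g \<in> f ` {1..m}\<close> by blast
    then show ?thesis
      using c(2)[OF i(1), of x y] mult_right_mono[OF C(3)[OF i(1)], of "dist x y"] by simp
  qed
  obtain V where V: "V \<noteq> {}" "open V"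
      "\<And>i j. \<lbrakk>i \<in> {1..m}; j \<in> {1..m}; i \<noteq> j\<rbrakk> \<Longrightarrow> f i ` V \<inter> f j ` V = {}"
      "(\<Union>i\<in>{1..m}. f i ` V) \<subseteq> V"
    using assms(4) unfolding open_set_condition_def by metis
  have "path_connected (frontier T)"
  proof (rule path_connected_frontier_attractor[where F = "f ` {1..m}" and c = C and V = V])
    show "g ` V \<inter> h ` V = {}" if "g \<in> f ` {1..m}" "h \<in> f ` {1..m}" "g \<noteq> h" for g h
      using that V(3) by blast
    show "g ` V \<subseteq> V" if "g \<in> f ` {1..m}" for g using that V(4) by blast
    show "inj g" if "g \<in> f ` {1..m}" for g using that assms(2) by blast
    show "T = (\<Union>g\<in>f ` {1..m}. g ` T)" using assms(7) by simp
    show "2 \<le> DIM(plane)" by simp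
  qed (use assms(5,6,8) V(1,2) C(1,2) lip in \<open>blast | simp\<close>)+
  then show ?thesis by (simp add: arcwise_connected_def path_connected_arcwise)
qed

end
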